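(* Let $(K_n,p)$ be a framework in a polyhedral normed space $(\mathbb{R}^2,\|\cdot\|_{\mathcal{P}})$ where the polygon $\mathcal{P}$ is a quadrilateral, and let $G_1$ and $G_2$ be the induced monochrome subgraphs. Then (i) $G_1$ and $G_2$ are odd-antihole-free graphs, and (ii) $G_1$ and $G_2$ are perfect graphs.
   Context: Let $\mathcal{P}$ be a convex centrally symmetric polytope in $\mathbb{R}^d$ (here $d=2$, a centrally symmetric quadrilateral containing the origin in its interior) with facets $\pm F_1,\ldots,\pm F_m$ (here $m=2$). Each facet is $F=\{x\in\mathcal{P}:x\cdot\hat F=1\}$ for a unique vector $\hat F$, and $\|x\|_{\mathcal{P}}=\max_j|\hat F_j\cdot x|$. A framework $(G,p)$ in this space is a graph $G=(V,E)$ with $p\in(\mathbb{R}^d)^V$ such that for each edge $vw$, $p_v\ne p_w$ and $(p_v-p_w)/\|p_v-p_w\|_{\mathcal{P}}$ lies in exactly one facet. $K_n$ is the complete graph on $n$ vertices. The monochrome subgraph $G_j$ has vertex set $V$ and edge set $\{vw\in E:p_v-p_w\in\operatorname{cone}(F_j)\cup\operatorname{cone}(-F_j)\}$. A hole is an induced cycle of length at least four, odd if of odd length; an antihole is an induced subgraph that is the complement of a hole, odd if it is the complement of an odd hole; a graph is odd-antihole-free if it has no odd antihole. *)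

theory Defs
  imports "HOL-Analysis.Analysis" "HOL-Library.Ramsey"
begin

section \<open>Simple graphs\<close>

text \<open>A graph is a pair of a vertex set and a set of two-element sets of vertices.\<close>

type_synonym 'a ugraph = "'a set \<times> 'a set set"

definition simple_graph :: "'a ugraph \<Rightarrow> bool" where
  "simple_graph G \<longleftrightarrow> finite (fst G) \<and> snd G \<subseteq> [fst G]\<^bsup>2\<^esup>"

definition complete_graph :: "nat \<Rightarrow> nat ugraph" where
  "complete_graph n = ({..<n}, [{..<n}]\<^bsup>2\<^esup>)"

definition induced_subgraph :: "'a ugraph \<Rightarrow> 'a set \<Rightarrow> 'a ugraph" where
  "induced_subgraph G S = (S, {e \<in> snd G. e \<subseteq> S})"

definition graph_complement :: "'a ugraph \<Rightarrow> 'a ugraph" where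
  "graph_complement G = (fst G, [fst G]\<^bsup>2\<^esup> - snd G)"

definition graph_iso :: "'a ugraph \<Rightarrow> 'b ugraph \<Rightarrow> bool" where
  "graph_iso G H \<longleftrightarrow> (\<exists>f. bij_betw f (fst G) (fst H) \<and> snd H = (image f) ` snd G)"

definition cycle_graph :: "nat \<Rightarrow> nat ugraph" where
  "cycle_graph k = ({..<k}, {{i, Suc i mod k} | i. i < k})"

definition is_cycle :: "'a ugraph \<Rightarrow> nat \<Rightarrow> bool" where
  "is_cycle G k \<longleftrightarrow> 3 \<le> k \<and> graph_iso G (cycle_graph k)"

text \<open>In the following two definitions the set \<open>S\<close> of vertices stands for the subgraph of \<open>G\<close>
  that it induces, and \<open>k\<close> is the length of the cycle.\<close>

definition hole :: "'a ugraph \<Rightarrow> 'a set \<Rightarrow> nat \<Rightarrow> bool" where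
  "hole G S k \<longleftrightarrow> S \<subseteq> fst G \<and> 4 \<le> k \<and> is_cycle (induced_subgraph G S) k"

definition antihole :: "'a ugraph \<Rightarrow> 'a set \<Rightarrow> nat \<Rightarrow> bool" where
  "antihole G S k \<longleftrightarrow>
     S \<subseteq> fst G \<and> 4 \<le> k \<and> is_cycle (graph_complement (induced_subgraph G S)) k"

definition odd_antihole_free :: "'a ugraph \<Rightarrow> bool" where
  "odd_antihole_free G \<longleftrightarrow> \<not> (\<exists>S k. odd k \<and> antihole G S k)"

definition proper_colouring :: "'a ugraph \<Rightarrow> nat \<Rightarrow> ('a \<Rightarrow> nat) \<Rightarrow> bool" where
  "proper_colouring G k c \<longleftrightarrow>
     c ` fst G \<subseteq> {..<k} \<and> (\<forall>v\<in>fst G. \<forall>w\<in>fst G. {v, w} \<in> snd G \<longrightarrow> c v \<noteq> c w)"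

definition chromatic_number :: "'a ugraph \<Rightarrow> nat" where
  "chromatic_number G = (LEAST k. \<exists>c. proper_colouring G k c)"

definition clique_number :: "'a ugraph \<Rightarrow> nat" where
  "clique_number G = Max {card K | K. K \<subseteq> fst G \<and> clique K (snd G)}"

definition perfect_graph :: "'a ugraph \<Rightarrow> bool" where
  "perfect_graph G \<longleftrightarrow>
     (\<forall>S \<subseteq> fst G. chromatic_number (induced_subgraph G S) = clique_number (induced_subgraph G S))"

section \<open>Polyhedral norms and frameworks\<close>

definition polyhedral_unit_ball :: "'a::euclidean_space set \<Rightarrow> bool" where
  "polyhedral_unit_ball P \<longleftrightarrow> polytope P \<and> uminus ` P = P \<and> 0 \<in> interior P"

text \<open>The vector \<open>a\<close> is unique because the origin is not in the affine hull of a facet of \<open>P\<close>, so a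
  facet spans the space.\<close>

definition facet_vector :: "'a::euclidean_space set \<Rightarrow> 'a set \<Rightarrow> 'a" where
  "facet_vector P F = (THE a. F = {x \<in> P. x \<bullet> a = 1})"

text \<open>The maximum is over all facets. Opposite facets have opposite facet vectors and contribute the
  same absolute value, so this is the maximum over one facet from each opposite pair.\<close>

definition polyhedral_norm :: "'a::euclidean_space set \<Rightarrow> 'a \<Rightarrow> real" where
  "polyhedral_norm P x = Max {\<bar>facet_vector P F \<bullet> x\<bar> | F. F facet_of P}"

definition framework ::
    "'a::euclidean_space set \<Rightarrow> 'v ugraph \<Rightarrow> ('v \<Rightarrow> 'a) \<Rightarrow> bool" where
  "framework P G p \<longleftrightarrow> simple_graph G \<and>
     (\<forall>v w. {v, w} \<in> snd G \<longrightarrow> p v \<noteq> p w \<and>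
        (\<exists>!F. F facet_of P \<and> (p v - p w) /\<^sub>R polyhedral_norm P (p v - p w) \<in> F))"

definition monochrome_subgraph ::
    "'v ugraph \<Rightarrow> ('v \<Rightarrow> 'a::euclidean_space) \<Rightarrow> 'a set \<Rightarrow> 'v ugraph" where
  "monochrome_subgraph G p F =
     (fst G, {{v, w} | v w. {v, w} \<in> snd G \<and>
                p v - p w \<in> cone hull F \<union> cone hull (uminus ` F)})"

end

theory Submission
  imports Defs
begin

text \<open>The cone over a facet \<open>F\<close> is convex and pointed, so \<open>p w - p v \<in> cone F - {0}\<close> is a strict
  partial order on the vertices and the monochrome subgraph is its comparability graph. Colouring
  each vertex by the size of the largest chain strictly below it (Mirsky's theorem) shows that a
  comparability graph is perfect. A perfect graph has no odd antihole: in the complement of a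
  \<open>k\<close>-cycle cliques have size at most \<open>k/2\<close> and colour classes have size at most 2, so equality of
  the clique and chromatic numbers forces \<open>k\<close> to be even.\<close>

section \<open>Colourings and cliques\<close>

lemma simple_graph_induced_subgraph:
  assumes "simple_graph G" "S \<subseteq> fst G"
  shows "simple_graph (induced_subgraph G S)"
  using assms finite_subset[OF assms(2)]
  by (auto simp: simple_graph_def induced_subgraph_def nsets_def)

lemma simple_graph_no_loop: "simple_graph G \<Longrightarrow> {v} \<notin> snd G"
  by (auto simp: simple_graph_def nsets_def)

lemma finite_clique_sizes:
  assumes "finite (fst G)"
  shows "finite {card K | K. K \<subseteq> fst G \<and> clique K (snd G)}"
proof (rule finite_subset)
  show "{card K | K. K \<subseteq> fst G \<and> clique K (snd G)} \<subseteq> card ` Pow (fst G)"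
    by auto
qed (use assms in simp)

lemma clique_card_le_clique_number:
  assumes "finite (fst G)" "K \<subseteq> fst G" "clique K (snd G)"
  shows "card K \<le> clique_number G"
  unfolding clique_number_def
  by (rule Max_ge[OF finite_clique_sizes]) (use assms in auto)

lemma obtain_maximum_clique:
  assumes "finite (fst G)"
  obtains K where "K \<subseteq> fst G" "clique K (snd G)" "card K = clique_number G"
proof -
  have "card ({} :: 'a set) \<in> {card K | K. K \<subseteq> fst G \<and> clique K (snd G)}"
    by (rule CollectI) (intro exI[of _ "{}"], simp add: clique_def)
  then have "clique_number G \<in> {card K | K. K \<subseteq> fst G \<and> clique K (snd G)}"
    unfolding clique_number_def
    by (intro Max_in finite_clique_sizes assms) blast
  then show ?thesis using that by auto
qed

lemma clique_card_le_colours: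
  assumes "proper_colouring G k c" "K \<subseteq> fst G" "clique K (snd G)"
  shows "card K \<le> k"
proof -
  have "inj_on c K"
    using assms unfolding proper_colouring_def clique_def inj_on_def by blast
  moreover have "c ` K \<subseteq> {..<k}"
    using assms unfolding proper_colouring_def by blast
  ultimately show ?thesis
    using card_inj_on_le[of c K "{..<k}"] by simp
qed

text \<open>The \<open>LEAST\<close> in \<open>chromatic_number\<close> is meaningful once some
  proper colouring exists. Numbering the finitely many vertices injectively gives one; the absence
  of loops matters because \<open>proper_colouring\<close> also tests \<open>v = w\<close>.\<close>

lemma obtain_optimal_colouring:
  assumes "simple_graph G"
  obtains c where "proper_colouring G (chromatic_number G) c"
proof -
  have fin: "finite (fst G)" using assms by (simp add: simple_graph_def)
  obtain f where f: "bij_betw f (fst G) {..<card (fst G)}"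
    using ex_bij_betw_finite_nat[OF fin] by (auto simp: atLeast0LessThan)
  have "proper_colouring G (card (fst G)) f"
    using f simple_graph_no_loop[OF assms]
    by (fastforce simp: proper_colouring_def bij_betw_def inj_on_def)
  then have "\<exists>k c. proper_colouring G k c" by blast
  then have "\<exists>c. proper_colouring G (chromatic_number G) c"
    unfolding chromatic_number_def by (rule LeastI_ex)
  then show ?thesis using that by blast
qed

lemma clique_number_le_chromatic_number:
  assumes "simple_graph G"
  shows "clique_number G \<le> chromatic_number G"
proof -
  obtain K where "K \<subseteq> fst G" "clique K (snd G)" "card K = clique_number G"
    using obtain_maximum_clique assms unfolding simple_graph_def by blast
  moreover obtain c where "proper_colouring G (chromatic_number G) c"
    using obtain_optimal_colouring[OF assms] .
  ultimately show ?thesis using clique_card_le_colours by metis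
qed

section \<open>Comparability graphs\<close>

text \<open>The strict order is demanded on the vertex set only, so the same \<open>r\<close> serves
  every induced subgraph.\<close>

definition comparability_graph :: "'a ugraph \<Rightarrow> ('a \<Rightarrow> 'a \<Rightarrow> bool) \<Rightarrow> bool" where
  "comparability_graph G r \<longleftrightarrow> simple_graph G \<and>
     (\<forall>u\<in>fst G. \<forall>v\<in>fst G. \<forall>w\<in>fst G. r u v \<longrightarrow> r v w \<longrightarrow> r u w) \<and>
     (\<forall>v\<in>fst G. \<not> r v v) \<and>
     (\<forall>v\<in>fst G. \<forall>w\<in>fst G. {v, w} \<in> snd G \<longleftrightarrow> r v w \<or> r w v)"

lemma comparability_graph_induced_subgraph:
  assumes "comparability_graph G r" "S \<subseteq> fst G"
  shows "comparability_graph (induced_subgraph G S) r"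
proof -
  have "simple_graph (induced_subgraph G S)"
    using assms simple_graph_induced_subgraph unfolding comparability_graph_def by blast
  then show ?thesis
    using assms unfolding comparability_graph_def induced_subgraph_def fst_conv snd_conv
    by (smt (verit) insert_subset empty_subsetI mem_Collect_eq subset_iff)
qed

text \<open>Cliques of \<open>G\<close> are exactly the chains of \<open>r\<close>. The colour
  \<open>c v\<close> is the height of \<open>v\<close>: it rises along \<open>r\<close> and stays
  below \<open>clique_number G\<close>.\<close>

lemma comparability_graph_chromatic_number:
  assumes "comparability_graph G r"
  shows "chromatic_number G = clique_number G"
proof -
  have sg: "simple_graph G" and fin: "finite (fst G)"
    using assms by (auto simp: comparability_graph_def simple_graph_def)
  have trans: "r u w" if "u \<in> fst G" "v \<in> fst G" "w \<in> fst G" "r u v" "r v w" for u v w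
    using assms that unfolding comparability_graph_def by blast
  have irrefl: "\<not> r v v" if "v \<in> fst G" for v
    using assms that unfolding comparability_graph_def by blast
  have edge: "{v, w} \<in> snd G \<longleftrightarrow> r v w \<or> r w v" if "v \<in> fst G" "w \<in> fst G" for v w
    using assms that unfolding comparability_graph_def by blast
  \<comment> \<open>Chains are recorded as cliques so that their sizes compare directly with
    \<open>clique_number G\<close>. The empty chain belongs to every \<open>below v\<close>, so the
    maximum in \<open>c\<close> exists and minimal vertices get colour 0.\<close>
  define below where
    "below v = {K. K \<subseteq> fst G \<and> clique K (snd G) \<and> (\<forall>u\<in>K. r u v)}" for v
  define c where "c v = Max (card ` below v)" for v
  have fin_below: "finite (below v)" for v
    by (rule finite_subset[of _ "Pow (fst G)"]) (use fin in \<open>auto simp: below_def\<close>)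
  have below_ne: "below v \<noteq> {}" for v
    by (auto simp: below_def clique_def)
  have c_attained: "\<exists>K\<in>below v. c v = card K" for v
  proof -
    have "c v \<in> card ` below v"
      unfolding c_def using fin_below below_ne by (intro Max_in) auto
    then show ?thesis by blast
  qed
  have c_ge: "card K \<le> c v" if "K \<in> below v" for K v
    unfolding c_def using that fin_below by auto
  have insert_clique: "clique (insert v K) (snd G) \<and> card (insert v K) = Suc (card K)"
    if v: "v \<in> fst G" and K: "K \<in> below v" for v K
  proof
    show "clique (insert v K) (snd G)"
      unfolding clique_def
    proof (intro ballI impI)
      fix x y assume "x \<in> insert v K" "y \<in> insert v K" "x \<noteq> y"
      moreover have "{u, v} \<in> snd G \<and> {v, u} \<in> snd G" if "u \<in> K" for u
        using that v K edge[of u v] edge[of v u] by (auto simp: below_def)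
      ultimately show "{x, y} \<in> snd G"
        using K by (auto simp: below_def clique_def)
    qed
    have "v \<notin> K" "finite K"
      using irrefl v K fin finite_subset unfolding below_def by auto
    then show "card (insert v K) = Suc (card K)" by simp
  qed
  \<comment> \<open>Placing \<open>v\<close> on top of a largest chain below it gives a clique with
    one more vertex, hence the strict bound that \<open>{..<clique_number G}\<close>
    requires.\<close>
  have c_less: "c v < clique_number G" if v: "v \<in> fst G" for v
  proof -
    obtain K where K: "K \<in> below v" "c v = card K" using c_attained by blast
    then have "Suc (card K) \<le> clique_number G"
      using insert_clique[OF v K(1)] clique_card_le_clique_number[OF fin, of "insert v K"] v
      by (auto simp: below_def)
    with K show ?thesis by simp
  qed
  \<comment> \<open>By transitivity a largest chain below \<open>v\<close>, extended by
    \<open>v\<close> itself, lies below \<open>w\<close>.\<close>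
  have c_mono: "c v < c w" if v: "v \<in> fst G" and w: "w \<in> fst G" and vw: "r v w" for v w
  proof -
    obtain K where K: "K \<in> below v" "c v = card K" using c_attained by blast
    have "insert v K \<in> below w"
      using insert_clique[OF v K(1)] K(1) v vw trans[OF _ v w _ vw] unfolding below_def by auto
    then show ?thesis using c_ge[of "insert v K" w] insert_clique[OF v K(1)] K(2) by simp
  qed
  have "proper_colouring G (clique_number G) c"
    unfolding proper_colouring_def using c_less c_mono edge by (force simp: image_subset_iff)
  then have "chromatic_number G \<le> clique_number G"
    unfolding chromatic_number_def by (auto intro: Least_le)
  then show ?thesis using clique_number_le_chromatic_number[OF sg] by simp
qed

lemma comparability_graph_perfect: "comparability_graph G r \<Longrightarrow> perfect_graph G"
  unfolding perfect_graph_def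
  using comparability_graph_induced_subgraph comparability_graph_chromatic_number by blast

section \<open>Odd antiholes in perfect graphs\<close>

lemma cycle_graph_edge_iff:
  assumes "i < k" "j < k"
  shows "{i, j} \<in> snd (cycle_graph k) \<longleftrightarrow> j = Suc i mod k \<or> i = Suc j mod k"
  using assms by (auto simp: cycle_graph_def doubleton_eq_iff)

text \<open>A triangle would give three steps of 1 or -1 with sum 0 modulo \<open>k\<close>. The sum
  is 1, -1, 3 or -3, which is impossible for \<open>4 \<le> k\<close>.\<close>

lemma cycle_graph_clique_card:
  assumes "4 \<le> k" "T \<subseteq> {..<k}" "clique T (snd (cycle_graph k))"
  shows "card T \<le> 2"
proof (rule ccontr)
  assume "\<not> card T \<le> 2"
  then have "3 \<le> card T" by simp
  then obtain U where "U \<subseteq> T" "card U = 3" by (meson obtain_subset_with_card_n)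
  then obtain x y z where xyz: "x \<in> T" "y \<in> T" "z \<in> T" "x \<noteq> y" "y \<noteq> z" "x \<noteq> z"
    by (auto simp: card_3_iff)
  have adj: "j = Suc i mod k \<or> i = Suc j mod k" if "i \<in> T" "j \<in> T" "i \<noteq> j" for i j
    using that assms cycle_graph_edge_iff[of i k j] unfolding clique_def by auto
  have "x < k" "y < k" "z < k" using xyz assms(2) by auto
  with adj[of x y] adj[of y z] adj[of x z] xyz assms(1) show False
    by (auto simp: mod_Suc split: if_splits)
qed

text \<open>The shift by one step is injective and moves \<open>T\<close> to a set disjoint from
  \<open>T\<close>, so both copies fit into the \<open>k\<close> vertices.\<close>

lemma cycle_graph_independent_card:
  assumes "2 \<le> k" "T \<subseteq> {..<k}"
    and indep: "\<And>i j. i \<in> T \<Longrightarrow> j \<in> T \<Longrightarrow> i \<noteq> j \<Longrightarrow> {i, j} \<notin> snd (cycle_graph k)"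
  shows "2 * card T \<le> k"
proof -
  let ?s = "\<lambda>i. Suc i mod k"
  have fin: "finite T" using assms(2) finite_subset by blast
  have inj: "inj_on ?s T"
  proof (rule inj_onI)
    fix i j assume "i \<in> T" "j \<in> T" "?s i = ?s j"
    moreover from this have "i < k" "j < k" using assms(2) by auto
    ultimately show "i = j" by (auto simp: mod_Suc split: if_splits)
  qed
  \<comment> \<open>The bound \<open>2 \<le> k\<close> makes \<open>?s i\<close> differ from
    \<open>i\<close>, as \<open>indep\<close> requires.\<close>
  have "?s i \<notin> T" if "i \<in> T" for i
  proof
    assume "?s i \<in> T"
    moreover have "i < k" using that assms(2) by auto
    ultimately show False
      using indep[of i "?s i"] that assms(1) cycle_graph_edge_iff[of i k "?s i"]
      by (auto simp: mod_Suc split: if_splits)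
  qed
  then have "card (T \<union> ?s ` T) = 2 * card T"
    using fin by (subst card_Un_disjoint) (auto simp: card_image[OF inj])
  moreover have "T \<union> ?s ` T \<subseteq> {..<k}" using assms(1,2) by auto
  ultimately show ?thesis using card_mono[of "{..<k}" "T \<union> ?s ` T"] by simp
qed

text \<open>Complementation exchanges the two bounds for cycles: cliques of the antihole are
  independent in the cycle, and its colour classes are cliques there. Thus \<open>k\<close> is
  squeezed between twice the clique number and twice the chromatic number.\<close>

lemma perfect_graph_odd_antihole_free:
  assumes "simple_graph G" "perfect_graph G"
  shows "odd_antihole_free G"
  unfolding odd_antihole_free_def
proof (safe)
  fix S k
  assume "odd k" and ah: "antihole G S k"
  define H where "H = induced_subgraph G S"
  have S: "S \<subseteq> fst G" and k: "4 \<le> k" using ah by (auto simp: antihole_def)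
  have sgH: "simple_graph H" and fstH: "fst H = S"
    using simple_graph_induced_subgraph[OF assms(1) S] by (auto simp: H_def induced_subgraph_def)
  have fin: "finite S" using sgH fstH by (auto simp: simple_graph_def)
  obtain f where f: "bij_betw f S {..<k}"
    and E: "snd (cycle_graph k) = image f ` ([S]\<^bsup>2\<^esup> - snd H)"
    using ah fstH
    by (auto simp: antihole_def is_cycle_def graph_iso_def graph_complement_def
        cycle_graph_def H_def[symmetric])
  have inj: "inj_on f S" and img: "f ` S = {..<k}" using f by (auto simp: bij_betw_def)
  \<comment> \<open>Injectivity of \<open>f\<close> pulls an edge of the cycle back to a unique
    pair. The case \<open>v = w\<close> is excluded because a singleton is an edge of neither
    graph.\<close>
  have edge: "{v, w} \<in> snd H \<longleftrightarrow> {f v, f w} \<notin> snd (cycle_graph k)"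
    if "v \<in> S" "w \<in> S" "v \<noteq> w" for v w
  proof -
    have "{f v, f w} \<in> image f ` ([S]\<^bsup>2\<^esup> - snd H) \<longleftrightarrow> {v, w} \<in> [S]\<^bsup>2\<^esup> - snd H"
    proof
      assume "{f v, f w} \<in> image f ` ([S]\<^bsup>2\<^esup> - snd H)"
      then obtain e where e: "e \<in> [S]\<^bsup>2\<^esup> - snd H" "f ` {v, w} = f ` e" by auto
      moreover have "e \<subseteq> S" using e(1) by (auto simp: nsets_def)
      ultimately have "{v, w} = e"
        using inj_on_image_eq_iff[OF inj, of "{v, w}" e] that by blast
      with e show "{v, w} \<in> [S]\<^bsup>2\<^esup> - snd H" by simp
    next
      assume "{v, w} \<in> [S]\<^bsup>2\<^esup> - snd H"
      then show "{f v, f w} \<in> image f ` ([S]\<^bsup>2\<^esup> - snd H)"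
        by (metis image_eqI image_empty image_insert)
    qed
    moreover have "{v, w} \<in> [S]\<^bsup>2\<^esup>" using that by (auto simp: nsets_def)
    ultimately show ?thesis using E by simp
  qed
  have "2 * clique_number H \<le> k"
  proof -
    obtain K where K: "K \<subseteq> S" "clique K (snd H)" "card K = clique_number H"
      using obtain_maximum_clique[of H] fin fstH by metis
    have "2 * card (f ` K) \<le> k"
    proof (rule cycle_graph_independent_card)
      fix i j assume "i \<in> f ` K" "j \<in> f ` K" "i \<noteq> j"
      then obtain v w where "v \<in> K" "w \<in> K" "v \<noteq> w" "i = f v" "j = f w" by auto
      then show "{i, j} \<notin> snd (cycle_graph k)"
        using K edge[of v w] unfolding clique_def by blast
    qed (use k K img in auto)
    moreover have "card (f ` K) = card K"
      using K(1) inj by (meson card_image inj_on_subset)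
    ultimately show ?thesis using K by simp
  qed
  moreover have "k \<le> 2 * chromatic_number H"
  proof -
    obtain c where c: "proper_colouring H (chromatic_number H) c"
      using obtain_optimal_colouring[OF sgH] .
    let ?cls = "\<lambda>j. {v \<in> S. c v = j}"
    have cls: "card (?cls j) \<le> 2" for j
    proof -
      have "card (f ` ?cls j) \<le> 2"
      proof (rule cycle_graph_clique_card[OF k])
        show "clique (f ` ?cls j) (snd (cycle_graph k))"
          unfolding clique_def
        proof (intro ballI impI)
          fix x y assume xy: "x \<in> f ` ?cls j" "y \<in> f ` ?cls j" "x \<noteq> y"
          obtain v where v: "v \<in> ?cls j" "x = f v" using xy(1) by (rule imageE)
          obtain w where w: "w \<in> ?cls j" "y = f w" using xy(2) by (rule imageE)
          have vw: "v \<in> S" "w \<in> S" "c v = c w" "v \<noteq> w" "x = f v" "y = f w"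
            using v w xy(3) by auto
          then have "{v, w} \<notin> snd H" using c fstH unfolding proper_colouring_def by metis
          then show "{x, y} \<in> snd (cycle_graph k)" using edge[of v w] vw by simp
        qed
      qed (use img in auto)
      moreover have "card (f ` ?cls j) = card (?cls j)"
        by (rule card_image) (rule inj_on_subset[OF inj], auto)
      ultimately show ?thesis by simp
    qed
    \<comment> \<open>The colour classes cover the \<open>k\<close> vertices of \<open>S\<close> and
      have at most two elements each.\<close>
    have "S = (\<Union>j<chromatic_number H. ?cls j)"
      using c fstH by (auto simp: proper_colouring_def)
    then have "card S \<le> (\<Sum>j<chromatic_number H. card (?cls j))"
      using card_UN_le[of "{..<chromatic_number H}" ?cls] by simp
    also have "\<dots> \<le> (\<Sum>j<chromatic_number H. 2)" by (rule sum_mono) (rule cls)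
    finally show ?thesis using bij_betw_same_card[OF f] by simp
  qed
  moreover have "chromatic_number H = clique_number H"
    using assms(2) S by (simp add: perfect_graph_def H_def)
  ultimately have "k = 2 * clique_number H" by simp
  with \<open>odd k\<close> show False by simp
qed

section \<open>Monochrome subgraphs\<close>

text \<open>A functional that is constant and positive on \<open>F\<close> certifies that the cone
  over \<open>F\<close> is pointed. Positivity comes from the origin being interior to
  \<open>P\<close>.\<close>

lemma facet_supporting_vector:
  fixes P :: "'a::euclidean_space set"
  assumes "polyhedral_unit_ball P" "F facet_of P"
  obtains a b where "0 < b" "\<And>x. x \<in> F \<Longrightarrow> a \<bullet> x = b"
proof -
  have P: "polytope P" "0 \<in> interior P" using assms by (auto simp: polyhedral_unit_ball_def)
  obtain a b where ab: "a \<noteq> 0" "P \<subseteq> {x. a \<bullet> x \<le> b}" "F = P \<inter> {x. a \<bullet> x = b}"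
    using facet_of_polyhedron[OF polytope_imp_polyhedron[OF P(1)] assms(2)] by metis
  obtain e where e: "0 < e" "cball 0 e \<subseteq> P"
    using P(2) by (auto simp: mem_interior_cball)
  \<comment> \<open>This point has norm \<open>e\<close>, so it lies in the ball, and the functional
    is positive there; the supporting inequality then forces \<open>b\<close> to be
    positive.\<close>
  have "(e / norm a) *\<^sub>R a \<in> P"
    using e ab(1) by (auto simp: subset_iff dist_norm)
  then have "(e / norm a) * (a \<bullet> a) \<le> b" using ab(2) by auto
  moreover have "0 < (e / norm a) * (a \<bullet> a)" using e ab(1) by simp
  ultimately have "0 < b" by linarith
  then show ?thesis using ab(3) that by auto
qed

text \<open>Lets the two opposite cones in \<open>monochrome_subgraph\<close> be read as the two
  orientations of one order relation.\<close>

lemma mem_cone_hull_uminus_iff: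
  fixes x :: "'a::real_vector"
  shows "x \<in> cone hull (uminus ` F) \<longleftrightarrow> - x \<in> cone hull F"
proof
  assume "x \<in> cone hull (uminus ` F)"
  then obtain c y where "0 \<le> c" "y \<in> F" "x = c *\<^sub>R (- y)"
    by (auto simp: cone_hull_expl)
  then show "- x \<in> cone hull F"
    by (auto simp: cone_hull_expl)
next
  assume "- x \<in> cone hull F"
  then obtain c y where "0 \<le> c" "y \<in> F" "- x = c *\<^sub>R y"
    by (auto simp: cone_hull_expl)
  then have "0 \<le> c \<and> - y \<in> uminus ` F \<and> x = c *\<^sub>R (- y)"
    by (metis image_eqI add.inverse_inverse scaleR_minus_right)
  then show "x \<in> cone hull (uminus ` F)"
    unfolding cone_hull_expl by blast
qed

text \<open>Since 0 lies in the cone over a facet, the relation includes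
  \<open>p v \<noteq> p w\<close> to be irreflexive. Completeness of \<open>G\<close> ensures that
  every comparable pair is an edge.\<close>

lemma monochrome_subgraph_comparability:
  fixes P :: "'a::euclidean_space set"
  assumes ball: "polyhedral_unit_ball P" and F: "F facet_of P" and fw: "framework P G p"
    and complete: "snd G = [fst G]\<^bsup>2\<^esup>"
  shows "comparability_graph (monochrome_subgraph G p F) (\<lambda>v w. p v \<noteq> p w \<and> p w - p v \<in> cone hull F)"
proof -
  have sg: "simple_graph G" using fw by (simp add: framework_def)
  have inj: "p v \<noteq> p w" if "{v, w} \<in> snd G" for v w
    using fw that by (simp add: framework_def)
  have "convex F"
    using ball F face_of_imp_convex facet_of_imp_face_of by blast
  \<comment> \<open>A convex cone is closed under addition; this is the source of
    transitivity.\<close>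
  then have add: "x + y \<in> cone hull F" if "x \<in> cone hull F" "y \<in> cone hull F" for x y
    using that convex_cone[of "cone hull F"] convex_cone_hull[of F] cone_cone_hull[of F] by blast
  obtain a b where b: "0 < b" and ab: "\<And>x. x \<in> F \<Longrightarrow> a \<bullet> x = b"
    using facet_supporting_vector[OF ball F] by metis
  have pos: "0 < a \<bullet> x" if "x \<in> cone hull F" "x \<noteq> 0" for x
    using that ab b unfolding cone_hull_expl by auto
  let ?r = "\<lambda>v w. p v \<noteq> p w \<and> p w - p v \<in> cone hull F"
  have trans: "?r u w" if "?r u v" "?r v w" for u v w
  proof
    \<comment> \<open>The functional given by \<open>a\<close> strictly increases along the
      relation, so two successive steps cannot return to the starting position.\<close>
    have "0 < a \<bullet> (p v - p u)" "0 < a \<bullet> (p w - p v)" using that pos by auto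
    then show "p u \<noteq> p w" by (auto simp: inner_diff_right)
    show "p w - p u \<in> cone hull F" using that add[of "p w - p v" "p v - p u"] by simp
  qed
  have edge: "{v, w} \<in> snd (monochrome_subgraph G p F) \<longleftrightarrow> ?r v w \<or> ?r w v"
    if vw: "v \<in> fst G" "w \<in> fst G" for v w
  proof
    assume "{v, w} \<in> snd (monochrome_subgraph G p F)"
    then obtain v' w' where "{v, w} = {v', w'}" "{v', w'} \<in> snd G"
      "p v' - p w' \<in> cone hull F \<union> cone hull (uminus ` F)"
      by (auto simp: monochrome_subgraph_def)
    then show "?r v w \<or> ?r w v"
      using inj[of v' w'] by (auto simp: mem_cone_hull_uminus_iff doubleton_eq_iff)
  next
    assume r: "?r v w \<or> ?r w v"
    \<comment> \<open>Distinct positions force \<open>v \<noteq> w\<close>, so \<open>{v, w}\<close>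
      has two elements and is an edge by completeness.\<close>
    then have "{v, w} \<in> snd G" using vw complete by (auto simp: nsets_def card_2_iff)
    moreover have "p v - p w \<in> cone hull F \<union> cone hull (uminus ` F)"
      using r by (auto simp: mem_cone_hull_uminus_iff)
    ultimately show "{v, w} \<in> snd (monochrome_subgraph G p F)"
      by (auto simp: monochrome_subgraph_def)
  qed
  have "simple_graph (monochrome_subgraph G p F)"
    using sg by (auto simp: simple_graph_def monochrome_subgraph_def)
  moreover have fst: "fst (monochrome_subgraph G p F) = fst G"
    by (simp add: monochrome_subgraph_def)
  moreover have "\<forall>u\<in>fst G. \<forall>v\<in>fst G. \<forall>w\<in>fst G. ?r u v \<longrightarrow> ?r v w \<longrightarrow> ?r u w"
  proof (intro ballI impI)
    fix u v w assume "?r u v" "?r v w"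
    then show "?r u w" by (rule trans)
  qed
  moreover have "\<forall>v\<in>fst G. \<not> ?r v v" by simp
  moreover have "\<forall>v\<in>fst G. \<forall>w\<in>fst G.
      {v, w} \<in> snd (monochrome_subgraph G p F) \<longleftrightarrow> ?r v w \<or> ?r w v"
    by (intro ballI) (rule edge)
  ultimately show ?thesis
    unfolding comparability_graph_def fst by (intro conjI)
qed

theorem theorem4p4:
  fixes P F1 F2 :: "(real ^ 2) set"
    and n :: nat
    and p :: "nat \<Rightarrow> real ^ 2"
  assumes "polyhedral_unit_ball P"
    and "card {F. F facet_of P} = 4"
    and "{F. F facet_of P} = {F1, uminus ` F1, F2, uminus ` F2}"
    and "framework P (complete_graph n) p"
  defines "G1 \<equiv> monochrome_subgraph (complete_graph n) p F1"
    and "G2 \<equiv> monochrome_subgraph (complete_graph n) p F2"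
  shows "(odd_antihole_free G1 \<and> odd_antihole_free G2) \<and> (perfect_graph G1 \<and> perfect_graph G2)"
proof -
  have *: "odd_antihole_free (monochrome_subgraph (complete_graph n) p F) \<and>
      perfect_graph (monochrome_subgraph (complete_graph n) p F)" if F: "F facet_of P" for F
  proof -
    obtain r where r: "comparability_graph (monochrome_subgraph (complete_graph n) p F) r"
      using monochrome_subgraph_comparability[OF assms(1) F assms(4)]
      by (auto simp: complete_graph_def)
    \<comment> \<open>Perfection is obtained first, from the order; the absence of odd antiholes is
      then deduced from it.\<close>
    then show ?thesis
      using comparability_graph_perfect perfect_graph_odd_antihole_free
      unfolding comparability_graph_def by blast
  qed
  have "F1 facet_of P" "F2 facet_of P" using assms(3) by blast+
  then show ?thesis using * unfolding G1_def G2_def by blast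
qed

end
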